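(* Let $T$ be a closed symmetric relation with equal defect numbers in a Krein space $\mathfrak H$ with fundamental symmetry $J$. Then the maps $T_0\mapsto N:=T_0\cap T^\bot$ and $N\mapsto T_0:=T\,\widehat{\oplus}\,N$ are mutually inverse and establish a 1-1 correspondence between the set $\operatorname{Self}(T)$ of canonical self-adjoint extensions $T_0$ of $T$ and the set $\mathcal N$.
   Context: All spaces are complex. A relation in $\mathfrak H$ is a linear subset of $\mathfrak H^2$. A subspace is a closed linear subset. The Krein space $(\mathfrak H,[\cdot,\cdot])$ has inner product conjugate-linear in the first factor, and $(\mathfrak H,[\cdot,J\cdot])$ is a Hilbert space, which defines the topology. $T^+=\{(g,g')\in\mathfrak H^2:[f,g']=[f',g]\ \forall(f,f')\in T\}$; $T$ is symmetric if $T\subseteq T^+$, self-adjoint if $T=T^+$. $\operatorname{Self}(T)$ is the set of self-adjoint $T_0$ with $T\subseteq T_0\subseteq T^+$. $T$ has equal defect numbers $(d,d)$, $d\le\infty$, if $\dim\ker(JT^+-iI)=\dim\ker(JT^++iI)=d$, where $JT^+=\{(f,Jf'):(f,f')\in T^+\}$. $\mathfrak K=\mathfrak H^2$ is a Krein space with $[\hat f,\hat g]=-i[f,g']+i[f',g]$ for $\hat f=(f,f')$, $\hat g=(g,g')$, and fundamental symmetry $\widehat J(f,f')=(-iJf',iJf)$. The symbol $\bot$ in $\mathfrak K$ denotes orthogonality with respect to the Hilbert space inner product $[\hat f,\widehat J\hat g]=[f,Jg]+[f',Jg']$. A linear subset $L\subseteq\mathfrak K$ is neutral if $[\hat f,\hat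 f]=0$ for all $\hat f\in L$, and a neutral subspace $L$ is hyper-maximal neutral if $L$ equals its orthogonal complement with respect to the indefinite inner product $[\cdot,\cdot]$ of $\mathfrak K$. $G\,\widehat{\oplus}\,H=\{\hat g+\hat h:\hat g\in G,\hat h\in H\}$ denotes the componentwise sum with $G\bot H$. $\mathcal N$ is the set of all neutral subspaces $N$ of $\mathfrak K$ such that $N\subseteq T^+\cap T^\bot$ and such that $T\,\widehat{\oplus}\,N$ is a hyper-maximal neutral subspace of $\mathfrak K$. *)

theory Defs
  imports "HOL-Analysis.Analysis" "HOL-Library.Extended_Nat"
begin

(* A complex Krein space (H, ip) with a fixed fundamental symmetry J. The library has no class of
   complex vector spaces, so the complex scalar multiplication sc is a parameter; sc_of_real makes it
   extend the real one of the type class. The topology is that of the Hilbert space inner product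
   ip x (J y): its norm is the norm of the class banach (axiom ip_J_norm), which supplies
   completeness, and positive definiteness follows from the same axiom. *)
locale krein_space = vector_space sc
  for sc :: "complex \<Rightarrow> 'a::banach \<Rightarrow> 'a" +
  fixes ip :: "'a \<Rightarrow> 'a \<Rightarrow> complex"
    and J :: "'a \<Rightarrow> 'a"
  assumes sc_of_real: "sc (complex_of_real r) x = r *\<^sub>R x"
    and ip_cnj: "ip y x = cnj (ip x y)"
    and ip_add_right: "ip x (y + z) = ip x y + ip x z"
    and ip_scale_right: "ip x (sc c y) = c * ip x y"
    and J_linear: "Vector_Spaces.linear sc sc J"
    and J_involution: "J (J x) = x"
    and J_symmetric: "ip (J x) y = ip x (J y)"
    and ip_J_norm: "ip x (J x) = complex_of_real ((norm x)\<^sup>2)"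

text \<open>Linear relations in \<open>H\<close> are linear subsets of \<open>K = H \<times> H\<close>.\<close>

definition linear_relation :: "(complex \<Rightarrow> 'a::ab_group_add \<Rightarrow> 'a) \<Rightarrow> ('a \<times> 'a) set \<Rightarrow> bool" where
  "linear_relation sc T \<longleftrightarrow> module.subspace (module_prod.scale sc sc) T"

definition krein_adjoint :: "('a \<Rightarrow> 'a \<Rightarrow> complex) \<Rightarrow> ('a \<times> 'a) set \<Rightarrow> ('a \<times> 'a) set" where
  "krein_adjoint ip T = {(g, g'). \<forall>(f, f') \<in> T. ip f g' = ip f' g}"

definition symmetric_relation ::
  "(complex \<Rightarrow> 'a::ab_group_add \<Rightarrow> 'a) \<Rightarrow> ('a \<Rightarrow> 'a \<Rightarrow> complex) \<Rightarrow> ('a \<times> 'a) set \<Rightarrow> bool" where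
  "symmetric_relation sc ip T \<longleftrightarrow> linear_relation sc T \<and> T \<subseteq> krein_adjoint ip T"

definition selfadjoint_relation ::
  "(complex \<Rightarrow> 'a::ab_group_add \<Rightarrow> 'a) \<Rightarrow> ('a \<Rightarrow> 'a \<Rightarrow> complex) \<Rightarrow> ('a \<times> 'a) set \<Rightarrow> bool" where
  "selfadjoint_relation sc ip T \<longleftrightarrow> linear_relation sc T \<and> T = krein_adjoint ip T"

definition Self ::
  "(complex \<Rightarrow> 'a::ab_group_add \<Rightarrow> 'a) \<Rightarrow> ('a \<Rightarrow> 'a \<Rightarrow> complex) \<Rightarrow> ('a \<times> 'a) set \<Rightarrow> ('a \<times> 'a) set set"
  where "Self sc ip T =
    {T0. selfadjoint_relation sc ip T0 \<and> T \<subseteq> T0 \<and> T0 \<subseteq> krein_adjoint ip T}"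

definition rel_compose_op :: "('a \<Rightarrow> 'a) \<Rightarrow> ('a \<times> 'a) set \<Rightarrow> ('a \<times> 'a) set" where
  "rel_compose_op J R = {(f, J f') | f f'. (f, f') \<in> R}"

definition rel_minus_scalar ::
  "(complex \<Rightarrow> 'a::ab_group_add \<Rightarrow> 'a) \<Rightarrow> ('a \<times> 'a) set \<Rightarrow> complex \<Rightarrow> ('a \<times> 'a) set" where
  "rel_minus_scalar sc R z = {(f, f' - sc z f) | f f'. (f, f') \<in> R}"

definition rel_ker :: "('a::zero \<times> 'a) set \<Rightarrow> 'a set" where
  "rel_ker R = {f. (f, 0) \<in> R}"

(* Dimension with values in {0, 1, 2, ...} and infinity; vector_space.dim is a junk value on
   infinite-dimensional spaces. *)
definition ext_dim :: "(complex \<Rightarrow> 'a::ab_group_add \<Rightarrow> 'a) \<Rightarrow> 'a set \<Rightarrow> enat" where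
  "ext_dim sc V =
    (if \<exists>B. finite B \<and> V \<subseteq> module.span sc B then enat (vector_space.dim sc V) else \<infinity>)"

definition has_equal_defect_numbers ::
  "(complex \<Rightarrow> 'a::ab_group_add \<Rightarrow> 'a) \<Rightarrow> ('a \<Rightarrow> 'a \<Rightarrow> complex) \<Rightarrow> ('a \<Rightarrow> 'a) \<Rightarrow> ('a \<times> 'a) set \<Rightarrow> bool"
  where "has_equal_defect_numbers sc ip J T \<longleftrightarrow>
    (\<exists>d::enat.
      ext_dim sc
        (rel_ker (rel_minus_scalar sc (rel_compose_op J (krein_adjoint ip T)) \<i>)) = d \<and>
      ext_dim sc
        (rel_ker (rel_minus_scalar sc (rel_compose_op J (krein_adjoint ip T)) (- \<i>))) = d)"

definition ipK :: "('a \<Rightarrow> 'a \<Rightarrow> complex) \<Rightarrow> 'a \<times> 'a \<Rightarrow> 'a \<times> 'a \<Rightarrow> complex" where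
  "ipK ip u v = - \<i> * ip (fst u) (snd v) + \<i> * ip (snd u) (fst v)"

definition JK :: "(complex \<Rightarrow> 'a \<Rightarrow> 'a) \<Rightarrow> ('a \<Rightarrow> 'a) \<Rightarrow> 'a \<times> 'a \<Rightarrow> 'a \<times> 'a" where
  "JK sc J u = (sc (- \<i>) (J (snd u)), sc \<i> (J (fst u)))"

definition hilbert_orth ::
  "(complex \<Rightarrow> 'a \<Rightarrow> 'a) \<Rightarrow> ('a \<Rightarrow> 'a \<Rightarrow> complex) \<Rightarrow> ('a \<Rightarrow> 'a) \<Rightarrow> ('a \<times> 'a) set \<Rightarrow> ('a \<times> 'a) set"
  where "hilbert_orth sc ip J L = {v. \<forall>u\<in>L. ipK ip u (JK sc J v) = 0}"

definition krein_orth :: "('a \<Rightarrow> 'a \<Rightarrow> complex) \<Rightarrow> ('a \<times> 'a) set \<Rightarrow> ('a \<times> 'a) set" where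
  "krein_orth ip L = {v. \<forall>u\<in>L. ipK ip u v = 0}"

definition neutral_subspace ::
  "(complex \<Rightarrow> 'a::real_normed_vector \<Rightarrow> 'a) \<Rightarrow> ('a \<Rightarrow> 'a \<Rightarrow> complex) \<Rightarrow> ('a \<times> 'a) set \<Rightarrow> bool"
  where "neutral_subspace sc ip L \<longleftrightarrow>
    linear_relation sc L \<and> closed L \<and> (\<forall>u\<in>L. ipK ip u u = 0)"

definition hypermaximal_neutral ::
  "(complex \<Rightarrow> 'a::real_normed_vector \<Rightarrow> 'a) \<Rightarrow> ('a \<Rightarrow> 'a \<Rightarrow> complex) \<Rightarrow> ('a \<times> 'a) set \<Rightarrow> bool"
  where "hypermaximal_neutral sc ip L \<longleftrightarrow>
    neutral_subspace sc ip L \<and> L = krein_orth ip L"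

(* The underlying set of the orthogonal componentwise sum. It is only applied to G and H with
   H contained in the Hilbert orthogonal complement of G, which is what the orthogonality asks. *)
definition hat_sum :: "('a::plus \<times> 'a) set \<Rightarrow> ('a \<times> 'a) set \<Rightarrow> ('a \<times> 'a) set" (infixl "\<oplus>\<^sub>h" 65) where
  "G \<oplus>\<^sub>h H = {g + h | g h. g \<in> G \<and> h \<in> H}"

definition neutral_parameters ::
  "(complex \<Rightarrow> 'a::real_normed_vector \<Rightarrow> 'a) \<Rightarrow> ('a \<Rightarrow> 'a \<Rightarrow> complex) \<Rightarrow> ('a \<Rightarrow> 'a) \<Rightarrow> ('a \<times> 'a) set
    \<Rightarrow> ('a \<times> 'a) set set"
  where "neutral_parameters sc ip J T =
    {N. neutral_subspace sc ip N \<and>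
        N \<subseteq> krein_adjoint ip T \<inter> hilbert_orth sc ip J T \<and>
        hypermaximal_neutral sc ip (T \<oplus>\<^sub>h N)}"

context krein_space
begin

lemma ip_scale_left: "ip (sc c x) y = cnj c * ip x y"
  by (metis ip_cnj ip_scale_right complex_cnj_mult)

lemma ipK_JK: "ipK ip (f, f') (JK sc J (g, g')) = ip f (J g) + ip f' (J g')"
  by (simp add: ipK_def JK_def ip_scale_right del: scale_minus_left)

text \<open>The library's product norm on \<open>H \<times> H\<close> is the Hilbert space norm of \<open>K\<close>, so \<open>closed\<close>
  refers to the topology of the Krein space \<open>K\<close>.\<close>

lemma ipK_JK_norm: "ipK ip u (JK sc J u) = complex_of_real ((norm u)\<^sup>2)"
  by (cases u) (simp add: ipK_JK ip_J_norm norm_Pair)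

end

end

theory Submission
  imports Defs
begin

text \<open>
  Two observations carry the theorem.

  The Krein space adjoint of a relation is its orthogonal complement with respect to the indefinite
  inner product of \<open>K = H \<times> H\<close> (lemma \<open>krein_adjoint_eq_krein_orth\<close>). Hence the self-adjoint
  relations are exactly the hyper-maximal neutral subspaces of \<open>K\<close>
  (lemma \<open>selfadjoint_iff_hypermaximal\<close>); since taking adjoints reverses inclusions, every
  self-adjoint \<open>T0\<close> that contains \<open>T\<close> automatically lies below the adjoint of \<open>T\<close>.

  The Hilbert space \<open>K\<close> is the orthogonal sum of the closed subspace \<open>T\<close> and its complement. If
  \<open>T \<subseteq> T0\<close>, splitting an element of \<open>T0\<close> leaves both parts in \<open>T0\<close>, so \<open>T0\<close> is the sum of \<open>T\<close> and the
  part of \<open>T0\<close> orthogonal to \<open>T\<close>; conversely, the part of \<open>T + N\<close> orthogonal to \<open>T\<close> is \<open>N\<close> as soon as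
  \<open>N\<close> is orthogonal to \<open>T\<close>, because \<open>T\<close> meets its complement in \<open>0\<close>. This makes the two maps
  mutually inverse.

  The analytic content is the projection theorem \<open>orthogonal_projection_exists\<close> and the continuity
  of the inner product. Both are shown for an arbitrary Krein space and are then used in \<open>K\<close>, which
  is itself a Krein space with fundamental symmetry \<open>JK\<close> (lemma \<open>krein_space_square\<close>).
\<close>

section \<open>Geometry of a Krein space\<close>

context krein_space
begin

lemma J_add: "J (x + y) = J x + J y"
  using J_linear by (simp add: Vector_Spaces.linear_iff)

lemma J_scale: "J (sc c x) = sc c (J x)"
  using J_linear by (simp add: Vector_Spaces.linear_iff)

lemma ip_add_left: "ip (x + y) z = ip x z + ip y z"
  by (metis ip_cnj ip_add_right complex_cnj_add)

lemma ip_zero_right [simp]: "ip x 0 = 0"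
  using ip_add_right[of x 0 0] by simp

lemma ip_J_cnj: "ip y (J x) = cnj (ip x (J y))"
  by (metis ip_cnj J_symmetric)

lemma ip_J_uminus: "ip x (J (- y)) = - ip x (J y)"
proof -
  have "- y = sc (- 1) y"
    by simp
  then show ?thesis
    by (simp only: J_scale ip_scale_right) simp
qed

lemma norm_add_squared: "(norm (x + y))\<^sup>2 = (norm x)\<^sup>2 + (norm y)\<^sup>2 + 2 * Re (ip x (J y))"
proof -
  have "complex_of_real ((norm (x + y))\<^sup>2)
      = of_real ((norm x)\<^sup>2) + of_real ((norm y)\<^sup>2) + (ip x (J y) + cnj (ip x (J y)))"
    unfolding ip_J_norm[symmetric] using ip_J_cnj[of y x]
    by (simp add: J_add ip_add_left ip_add_right)
  also have "\<dots> = of_real ((norm x)\<^sup>2 + (norm y)\<^sup>2 + 2 * Re (ip x (J y)))"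
    by (simp add: complex_add_cnj)
  finally show ?thesis
    by (simp only: of_real_eq_iff)
qed

lemma norm_diff_squared: "(norm (x - y))\<^sup>2 = (norm x)\<^sup>2 + (norm y)\<^sup>2 - 2 * Re (ip x (J y))"
  using norm_add_squared[of x "- y"] by (simp add: ip_J_uminus)

lemma parallelogram:
  fixes x y :: 'a
  shows "(norm (x + y))\<^sup>2 + (norm (x - y))\<^sup>2 = 2 * (norm x)\<^sup>2 + 2 * (norm y)\<^sup>2"
  by (simp add: norm_add_squared norm_diff_squared)

lemma norm_scale_squared: "(norm (sc c x))\<^sup>2 = (cmod c)\<^sup>2 * (norm x)\<^sup>2"
proof -
  have "complex_of_real ((norm (sc c x))\<^sup>2) = (c * cnj c) * of_real ((norm x)\<^sup>2)"
    unfolding ip_J_norm[symmetric] by (simp add: J_scale ip_scale_left ip_scale_right)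
  also have "\<dots> = of_real ((cmod c)\<^sup>2 * (norm x)\<^sup>2)"
    by (simp flip: complex_norm_square)
  finally show ?thesis
    by (simp only: of_real_eq_iff)
qed

text \<open>By polarization the inner product is an expression in norms, hence continuous.\<close>

lemma ip_J_polarization:
  "ip x (J y) = Complex (((norm (x + y))\<^sup>2 - (norm x)\<^sup>2 - (norm y)\<^sup>2) / 2)
     (((norm (sc \<i> x + y))\<^sup>2 - (norm (sc \<i> x))\<^sup>2 - (norm y)\<^sup>2) / 2)"
  by (simp add: norm_add_squared ip_scale_left complex_eq_iff)

lemma continuous_on_ip_J: "continuous_on UNIV (\<lambda>y. ip x (J y))"
  unfolding ip_J_polarization by (intro continuous_intros) simp_all

lemma continuous_on_ip: "continuous_on UNIV (\<lambda>y. ip x y)"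
  using continuous_on_ip_J[of "J x"] by (simp add: J_symmetric J_involution)

lemma closed_orthogonal: "closed {v. \<forall>u\<in>L. ip u v = 0}"
proof -
  have "{v. \<forall>u\<in>L. ip u v = 0} = (\<Inter>u\<in>L. (\<lambda>v. ip u v) -` {0})"
    by auto
  then show ?thesis
    by (auto intro!: closed_vimage continuous_on_ip)
qed

lemma closed_J_orthogonal: "closed {v. \<forall>u\<in>L. ip u (J v) = 0}"
  using closed_orthogonal[of "J ` L"] by (simp add: J_symmetric)

lemma subspace_J_orthogonal: "subspace {v. \<forall>u\<in>L. ip u (J v) = 0}"
  using J_scale[of 0]
  by (auto simp: subspace_def J_add J_scale ip_add_right ip_scale_right)

text \<open>
  The points of \<open>S\<close> whose squared distance to \<open>x\<close> exceeds the infimum by at most \<open>1 / (n + 1)\<close> form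
  decreasing closed sets. The parallelogram law, with the midpoint of two of them again in \<open>S\<close>, shows
  that the diameters tend to \<open>0\<close>, so by completeness the sets have a common point.
\<close>

lemma nearest_point_exists:
  assumes S: "subspace S" and "closed S"
  obtains y where "y \<in> S" "\<And>z. z \<in> S \<Longrightarrow> norm (x - y) \<le> norm (x - z)"
proof -
  have "S \<noteq> {}"
    using S by (auto simp: subspace_def)
  define d where "d = (INF z\<in>S. (norm (x - z))\<^sup>2)"
  have bdd: "bdd_below ((\<lambda>z. (norm (x - z))\<^sup>2) ` S)"
    by (rule bdd_belowI[of _ 0]) auto
  have d_le: "d \<le> (norm (x - z))\<^sup>2" if "z \<in> S" for z
    unfolding d_def by (rule cINF_lower[OF bdd that])
  define C where "C n = {z \<in> S. (norm (x - z))\<^sup>2 \<le> d + inverse (real (Suc n))}" for n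
  have close: "(dist a b)\<^sup>2 \<le> 4 * inverse (real (Suc n))" if "a \<in> C n" "b \<in> C n" for a b n
  proof -
    have "a + b \<in> S"
      using that subspace_add[OF S] by (auto simp: C_def)
    then have mid: "(1 / 2) *\<^sub>R (a + b) \<in> S"
      using subspace_scale[OF S] sc_of_real by metis
    have "(x - a) + (x - b) = 2 *\<^sub>R (x - (1 / 2) *\<^sub>R (a + b))"
      by (simp add: algebra_simps scaleR_2)
    then have "(norm ((x - a) + (x - b)))\<^sup>2 = 4 * (norm (x - (1 / 2) *\<^sub>R (a + b)))\<^sup>2"
      by (simp add: power_mult_distrib)
    moreover have "norm ((x - a) - (x - b)) = dist a b"
      by (simp add: dist_norm norm_minus_commute)
    ultimately show ?thesis
      using parallelogram[of "x - a" "x - b"] d_le[OF mid] that by (simp add: C_def)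
  qed
  obtain y where y: "\<And>n. y \<in> C n"
  proof (rule decreasing_closed_nest)
    show "closed (C n)" for n
    proof -
      have "C n = S \<inter> {z. (norm (x - z))\<^sup>2 \<le> d + inverse (real (Suc n))}"
        by (auto simp: C_def)
      then show ?thesis
        using \<open>closed S\<close> by (auto intro!: closed_Int closed_Collect_le continuous_intros)
    qed
    show "C n \<noteq> {}" for n
    proof -
      have "d < d + inverse (real (Suc n))"
        by simp
      then obtain z where "z \<in> S" "(norm (x - z))\<^sup>2 < d + inverse (real (Suc n))"
        using cINF_less_iff[OF \<open>S \<noteq> {}\<close> bdd] unfolding d_def by blast
      then show ?thesis
        by (auto simp: C_def intro: less_imp_le)
    qed
    show "C n \<subseteq> C m" if "m \<le> n" for m n
    proof -
      have "inverse (real (Suc n)) \<le> inverse (real (Suc m))"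
        using that by (intro le_imp_inverse_le) auto
      then show ?thesis
        unfolding C_def by (auto simp del: of_nat_Suc intro: order_trans)
    qed
    show "\<exists>n. \<forall>a\<in>C n. \<forall>b\<in>C n. dist a b < e" if "0 < e" for e
    proof -
      have "0 < e\<^sup>2 / 4"
        using that by simp
      then obtain n where "inverse (real (Suc n)) < e\<^sup>2 / 4"
        using reals_Archimedean by blast
      then have "(dist a b)\<^sup>2 < e\<^sup>2" if "a \<in> C n" "b \<in> C n" for a b
        using close[OF that] by linarith
      then show ?thesis
        using \<open>0 < e\<close> by (meson less_imp_le power2_less_imp_less)
    qed
  qed (rule that)
  have "(norm (x - y))\<^sup>2 \<le> d"
  proof (rule field_le_epsilon)
    fix e :: real assume "0 < e"
    then obtain n where "inverse (real (Suc n)) < e"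
      using reals_Archimedean by blast
    then show "(norm (x - y))\<^sup>2 \<le> d + e"
      using y[of n] by (simp add: C_def)
  qed
  then have "norm (x - y) \<le> norm (x - z)" if "z \<in> S" for z
    using d_le[OF that] by (meson norm_ge_zero order_trans power2_le_imp_le)
  moreover have "y \<in> S"
    using y by (auto simp: C_def)
  ultimately show thesis
    using that by blast
qed

text \<open>
  If \<open>v\<close> is the difference of \<open>x\<close> and its nearest point in \<open>S\<close>, no multiple of \<open>t \<in> S\<close> subtracted from
  \<open>v\<close> shortens it. To first order, subtracting a small positive multiple of \<open>\<langle>t, v\<rangle> t\<close> would shorten \<open>v\<close>
  unless the Hilbert space inner product \<open>\<langle>t, v\<rangle>\<close> vanishes.
\<close>

lemma orthogonal_projection_exists:
  assumes S: "subspace S" and "closed S"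
  obtains y where "y \<in> S" "\<forall>t\<in>S. ip t (J (x - y)) = 0"
proof -
  obtain y where y: "y \<in> S" and min: "\<And>z. z \<in> S \<Longrightarrow> norm (x - y) \<le> norm (x - z)"
    using nearest_point_exists[OF assms] by blast
  have "ip t (J (x - y)) = 0" if "t \<in> S" for t
  proof (rule ccontr)
    define a where "a = ip t (J (x - y))"
    (* the change of the squared norm is r * (r * norm t ^ 2 - 2) * cmod a ^ 2, which is negative
       if 0 < r and r * norm t ^ 2 < 2 *)
    define r where "r = 1 / ((norm t)\<^sup>2 + 1)"
    assume "ip t (J (x - y)) \<noteq> 0"
    then have a: "0 < (cmod a)\<^sup>2"
      by (simp add: a_def)
    have r: "0 < r" "r * (norm t)\<^sup>2 < 1"
      by (auto simp: r_def divide_simps add_pos_nonneg add_nonneg_pos)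
    have "y + sc (of_real r * a) t \<in> S"
      using y that S by (intro subspace_add subspace_scale)
    from min[OF this] have
      "(norm (x - y))\<^sup>2 \<le> (norm ((x - y) - sc (of_real r * a) t))\<^sup>2"
      by (simp add: algebra_simps power_mono)
    also have "\<dots> = (norm (x - y))\<^sup>2 + r\<^sup>2 * (cmod a)\<^sup>2 * (norm t)\<^sup>2 - 2 * (r * (cmod a)\<^sup>2)"
    proof -
      have "ip (x - y) (J (sc (of_real r * a) t)) = of_real (r * (cmod a)\<^sup>2)"
        using ip_J_cnj[of "x - y" t]
        by (simp add: J_scale ip_scale_right flip: a_def complex_norm_square)
      then show ?thesis
        by (simp add: norm_diff_squared norm_scale_squared norm_mult power_mult_distrib)
    qed
    finally have "2 * (r * (cmod a)\<^sup>2) \<le> (r * (norm t)\<^sup>2) * (r * (cmod a)\<^sup>2)"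
      by (simp add: power2_eq_square algebra_simps)
    also have "\<dots> < 1 * (r * (cmod a)\<^sup>2)"
      using r a by (intro mult_strict_right_mono) auto
    finally show False
      using r a by (auto simp: mult_less_0_iff zero_less_mult_iff)
  qed
  then show thesis
    using y that by blast
qed

section \<open>The Krein space of pairs\<close>

lemma krein_space_square: "krein_space (module_prod.scale sc sc) (ipK ip) (JK sc J)"
proof -
  interpret P: vector_space_prod sc sc
    by unfold_locales
  show ?thesis
  proof (intro krein_space.intro krein_space_axioms.intro)
    show "vector_space P.scale"
      by (rule P.p.vector_space_axioms)
    show "P.scale (complex_of_real r) x = r *\<^sub>R x" for r x
      by (simp add: P.scale_def scaleR_prod_def sc_of_real)
    show "ipK ip y x = cnj (ipK ip x y)" for x y
      using ip_cnj[of "fst y" "snd x"] ip_cnj[of "snd y" "fst x"] by (simp add: ipK_def)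
    show "ipK ip x (y + z) = ipK ip x y + ipK ip x z" for x y z
      by (simp add: ipK_def ip_add_right algebra_simps)
    show "ipK ip x (P.scale c y) = c * ipK ip x y" for x c y
      by (simp add: ipK_def P.scale_def ip_scale_right algebra_simps)
    show "Vector_Spaces.linear P.scale P.scale (JK sc J)"
      unfolding Vector_Spaces.linear_iff using P.p.vector_space_axioms
      by (simp add: JK_def P.scale_def J_add J_scale scale_right_distrib mult.commute
          del: scale_minus_left)
    show "JK sc J (JK sc J x) = x" for x
      by (simp add: JK_def J_scale J_involution prod_eq_iff del: scale_minus_left)
    show "ipK ip (JK sc J x) y = ipK ip x (JK sc J y)" for x y
      by (simp add: ipK_def JK_def ip_scale_left ip_scale_right J_symmetric
          del: scale_minus_left)
    show "ipK ip x (JK sc J x) = complex_of_real ((norm x)\<^sup>2)" for x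
      by (rule ipK_JK_norm)
  qed
qed

end

lemma krein_adjoint_eq_krein_orth: "krein_adjoint ip T = krein_orth ip T"
  by (auto simp: krein_adjoint_def krein_orth_def ipK_def)

lemma krein_orth_antimono: "L \<subseteq> M \<Longrightarrow> krein_orth ip M \<subseteq> krein_orth ip L"
  by (auto simp: krein_orth_def)

context krein_space
begin

text \<open>
  A set that equals its own orthogonal complement is neutral, and it is closed because orthogonal
  complements are.
\<close>

lemma selfadjoint_iff_hypermaximal:
  "selfadjoint_relation sc ip L \<longleftrightarrow> hypermaximal_neutral sc ip L"
proof -
  interpret K: krein_space "module_prod.scale sc sc" "ipK ip" "JK sc J"
    by (rule krein_space_square)
  have "closed (krein_orth ip L)"
    unfolding krein_orth_def by (rule K.closed_orthogonal)
  moreover have "\<forall>u\<in>L. ipK ip u u = 0" if "L = krein_orth ip L"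
    using that by (auto simp: krein_orth_def)
  ultimately show ?thesis
    unfolding selfadjoint_relation_def hypermaximal_neutral_def neutral_subspace_def
      krein_adjoint_eq_krein_orth
    by auto
qed

section \<open>The correspondence\<close>

lemma Self_eq_hypermaximal_extensions:
  "Self sc ip T = {T0. hypermaximal_neutral sc ip T0 \<and> T \<subseteq> T0}"
proof -
  have "T0 \<subseteq> krein_orth ip T" if "hypermaximal_neutral sc ip T0" "T \<subseteq> T0" for T0
    using that krein_orth_antimono[of T T0] by (auto simp: hypermaximal_neutral_def)
  then show ?thesis
    by (auto simp: Self_def selfadjoint_iff_hypermaximal krein_adjoint_eq_krein_orth)
qed

lemma hat_sumI: "g \<in> G \<Longrightarrow> h \<in> H \<Longrightarrow> g + h \<in> G \<oplus>\<^sub>h H"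
  unfolding hat_sum_def by blast

lemma hat_sum_orthogonal_part:
  assumes T: "linear_relation sc T" "closed T" and T0: "linear_relation sc T0" and "T \<subseteq> T0"
  shows "T \<oplus>\<^sub>h (T0 \<inter> hilbert_orth sc ip J T) = T0"
proof -
  interpret K: krein_space "module_prod.scale sc sc" "ipK ip" "JK sc J"
    by (rule krein_space_square)
  note T = T[unfolded linear_relation_def] and T0 = T0[unfolded linear_relation_def]
  have "u \<in> T \<oplus>\<^sub>h (T0 \<inter> hilbert_orth sc ip J T)" if "u \<in> T0" for u
  proof -
    obtain t where t: "t \<in> T" "\<forall>s\<in>T. ipK ip s (JK sc J (u - t)) = 0"
      using K.orthogonal_projection_exists[OF T] by blast
    then have "u - t \<in> T0 \<inter> hilbert_orth sc ip J T"
      using K.subspace_diff[OF T0 that] \<open>T \<subseteq> T0\<close> unfolding hilbert_orth_def by blast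
    from hat_sumI[OF t(1) this] show ?thesis
      by simp
  qed
  then show ?thesis
    using \<open>T \<subseteq> T0\<close> K.subspace_add[OF T0] by (auto simp: hat_sum_def)
qed

lemma orthogonal_part_hat_sum:
  assumes T: "linear_relation sc T" and N: "N \<subseteq> hilbert_orth sc ip J T"
  shows "(T \<oplus>\<^sub>h N) \<inter> hilbert_orth sc ip J T = N"
proof -
  interpret K: krein_space "module_prod.scale sc sc" "ipK ip" "JK sc J"
    by (rule krein_space_square)
  note T = T[unfolded linear_relation_def]
  have orth: "K.subspace (hilbert_orth sc ip J T)"
    unfolding hilbert_orth_def by (rule K.subspace_J_orthogonal)
  have "t + n \<in> N" if t: "t \<in> T" and n: "n \<in> N" and "t + n \<in> hilbert_orth sc ip J T" for t n
  proof -
    have "(t + n) - n \<in> hilbert_orth sc ip J T"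
      using that N by (intro K.subspace_diff[OF orth]) auto
    then have "ipK ip t (JK sc J t) = 0"
      using t by (simp add: hilbert_orth_def)
    then have "t = 0"
      by (simp add: K.ip_J_norm)
    then show ?thesis
      using n by simp
  qed
  moreover have "n \<in> T \<oplus>\<^sub>h N" if "n \<in> N" for n
    using hat_sumI[OF K.subspace_0[OF T] that] by simp
  ultimately show ?thesis
    using N by (auto simp: hat_sum_def)
qed

lemma orthogonal_part_in_neutral_parameters:
  assumes T: "linear_relation sc T" "closed T" and T0: "T0 \<in> Self sc ip T"
  shows "T0 \<inter> hilbert_orth sc ip J T \<in> neutral_parameters sc ip J T"
proof -
  interpret K: krein_space "module_prod.scale sc sc" "ipK ip" "JK sc J"
    by (rule krein_space_square)
  have hyper: "hypermaximal_neutral sc ip T0" and "T \<subseteq> T0"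
    using T0 by (auto simp: Self_eq_hypermaximal_extensions)
  then have lin: "linear_relation sc T0" and clo: "closed T0" and neu: "\<forall>u\<in>T0. ipK ip u u = 0"
    by (auto simp: hypermaximal_neutral_def neutral_subspace_def)
  have "closed (T0 \<inter> hilbert_orth sc ip J T)"
    using clo K.closed_J_orthogonal[of T] unfolding hilbert_orth_def by (rule closed_Int)
  moreover have "linear_relation sc (T0 \<inter> hilbert_orth sc ip J T)"
    using lin K.subspace_J_orthogonal[of T] unfolding linear_relation_def hilbert_orth_def
    by (rule K.subspace_inter)
  moreover have "T0 \<subseteq> krein_adjoint ip T"
    using T0 by (simp add: Self_def)
  ultimately show ?thesis
    using neu hyper hat_sum_orthogonal_part[OF T lin \<open>T \<subseteq> T0\<close>]
    by (auto simp: neutral_parameters_def neutral_subspace_def)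
qed

lemma hat_sum_in_Self:
  assumes "N \<in> neutral_parameters sc ip J T"
  shows "T \<oplus>\<^sub>h N \<in> Self sc ip T"
proof -
  interpret K: krein_space "module_prod.scale sc sc" "ipK ip" "JK sc J"
    by (rule krein_space_square)
  have "0 \<in> N"
    using assms K.subspace_0
    by (auto simp: neutral_parameters_def neutral_subspace_def linear_relation_def)
  then have "T \<subseteq> T \<oplus>\<^sub>h N"
    using hat_sumI[of _ T 0 N] by auto
  then show ?thesis
    using assms by (simp add: Self_eq_hypermaximal_extensions neutral_parameters_def)
qed

end

theorem theorem3p2:
  fixes sc :: "complex \<Rightarrow> 'a::banach \<Rightarrow> 'a"
    and ip :: "'a \<Rightarrow> 'a \<Rightarrow> complex"
    and J :: "'a \<Rightarrow> 'a"
    and T :: "('a \<times> 'a) set"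
  assumes "krein_space sc ip J"
    and "symmetric_relation sc ip T"
    and "closed T"
    and "has_equal_defect_numbers sc ip J T"
  shows "bij_betw (\<lambda>T0. T0 \<inter> hilbert_orth sc ip J T)
           (Self sc ip T) (neutral_parameters sc ip J T)
       \<and> bij_betw (\<lambda>N. T \<oplus>\<^sub>h N)
           (neutral_parameters sc ip J T) (Self sc ip T)
       \<and> (\<forall>T0 \<in> Self sc ip T. T \<oplus>\<^sub>h (T0 \<inter> hilbert_orth sc ip J T) = T0)
       \<and> (\<forall>N \<in> neutral_parameters sc ip J T. (T \<oplus>\<^sub>h N) \<inter> hilbert_orth sc ip J T = N)"
proof -
  interpret krein_space sc ip J
    by fact
  have T: "linear_relation sc T"
    using assms(2) by (simp add: symmetric_relation_def)
  have left: "T \<oplus>\<^sub>h (T0 \<inter> hilbert_orth sc ip J T) = T0" if "T0 \<in> Self sc ip T" for T0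
    using that hat_sum_orthogonal_part[OF T \<open>closed T\<close>]
    by (simp add: Self_def selfadjoint_relation_def)
  have right: "(T \<oplus>\<^sub>h N) \<inter> hilbert_orth sc ip J T = N"
    if "N \<in> neutral_parameters sc ip J T" for N
    using that by (intro orthogonal_part_hat_sum[OF T]) (simp add: neutral_parameters_def)
  have into: "T0 \<inter> hilbert_orth sc ip J T \<in> neutral_parameters sc ip J T"
    if "T0 \<in> Self sc ip T" for T0
    by (rule orthogonal_part_in_neutral_parameters[OF T \<open>closed T\<close> that])
  have "bij_betw (\<lambda>T0. T0 \<inter> hilbert_orth sc ip J T) (Self sc ip T) (neutral_parameters sc ip J T)"
    by (rule bij_betw_byWitness[where f' = "\<lambda>N. T \<oplus>\<^sub>h N"])
      (use left right into hat_sum_in_Self in auto)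
  moreover have "bij_betw (\<lambda>N. T \<oplus>\<^sub>h N) (neutral_parameters sc ip J T) (Self sc ip T)"
    by (rule bij_betw_byWitness[where f' = "\<lambda>T0. T0 \<inter> hilbert_orth sc ip J T"])
      (use left right into hat_sum_in_Self in auto)
  ultimately show ?thesis
    using left right by blast
qed

end
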